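(* Let $P_{YZ}$ be a joint probability distribution of random variables $Y,Z$ with finite alphabets. The converse bound for privacy amplification stating that every privacy amplification protocol for $P_{YZ}$ with output size $K$ and error $\varepsilon$ must satisfy $$\varepsilon\ \ge\ E_{|Y|/K}(P_{YZ},R_Y\times P_Z)$$ is equivalent to the bound $$\frac{1}{K_\varepsilon(Y|Z)_P}\ \ge\ \bar\lambda^{\varepsilon}_{\min}(Y|Z)_P .$$
   Context: All alphabets are finite, and probability mass functions are regarded as real vectors; $|Y|$ denotes the alphabet size of $Y$. $\mathbb 1$ is the all-ones vector, $R_Y$ is the uniform distribution on the alphabet of $Y$, $\times$ is the product, $P_Z$ is the marginal of $P_{YZ}$, and $\mathbb 1_YP_Z$ is the vector with entries $(y,z)\mapsto P_Z(z)$. Inequalities between vectors are entrywise and $\langle\cdot,\cdot\rangle$ is the Euclidean inner product. The variational distance is $\delta(P,Q)=\tfrac12\|P-Q\|_1$. Privacy amplification: a function $f:Y\to V$ is a privacy amplification protocol for $P_{YZ}$ (of $Y$ relative to $Z$) with output size $K$ and error $\varepsilon$ if, with $V=f(Y)$, $|V|=K$ and $\delta(P_{VZ},R_V\times P_Z)\le\varepsilon$, where $R_V$ is the uniform distribution on the alphabet of $V$. $K_\varepsilon(Y|Z)_P$ is the largest $K\in\mathbb N$ for which such a protocol exists. For $\gamma>0$ and probability vectors $P,Q$, with $A_\gamma=\{x:P(x)\ge\gamma Q(x)\}$, $$E_\gamma(P,Q):=P[A_\gamma]-\gamma\,Q[A_\gamma]=\max_{0\le\Lambda\le\mathbb 1}\big(\langle\Lambda,P\rangle-\gamma\langle\Lambda,Q\rangle\big).$$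 Further, $$\bar\lambda^{\varepsilon}_{\min}(Y|Z)_P:=\min\{\lambda:\ \lambda\,\mathbb 1_YP_Z\ge P_{YZ}-T_{YZ},\ \langle\mathbb 1_{YZ},T_{YZ}\rangle\le\varepsilon;\ \lambda\ge0,\ T_{YZ}\ge0\},$$ the minimum being over real $\lambda$ and real vectors $T_{YZ}$ indexed by pairs $(y,z)$. *)

theory Defs
  imports "HOL-Probability.Probability"
begin

text \<open>Alphabets of \<open>Y\<close> and \<open>Z\<close> are finite types; \<open>P\<^sub>Z\<close> is \<open>map_pmf snd P\<close>,
  \<open>R\<^sub>Y\<close> is \<open>pmf_of_set UNIV\<close> and the product is \<open>pair_pmf\<close>.\<close>

text \<open>Off the two supports the summand vanishes, so for finitely supported \<open>P\<close> and \<open>Q\<close> this is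
  half the \<open>\<ell>\<^sub>1\<close>-distance.\<close>

definition var_dist :: "'a pmf \<Rightarrow> 'a pmf \<Rightarrow> real" where
  "var_dist P Q = (1/2) * (\<Sum>x \<in> set_pmf P \<union> set_pmf Q. \<bar>pmf P x - pmf Q x\<bar>)"

definition E_gamma :: "real \<Rightarrow> 'a pmf \<Rightarrow> 'a pmf \<Rightarrow> real" where
  "E_gamma \<gamma> P Q =
     (let A = {x. pmf P x \<ge> \<gamma> * pmf Q x}
      in measure_pmf.prob P A - \<gamma> * measure_pmf.prob Q A)"

text \<open>\<open>V\<close> is the output alphabet (the codomain of \<open>f\<close>); \<open>f\<close> is not required to be onto \<open>V\<close>.\<close>

definition pa_protocol ::
  "('y::finite \<times> 'z::finite) pmf \<Rightarrow> ('y \<Rightarrow> 'v) \<Rightarrow> 'v set \<Rightarrow> nat \<Rightarrow> real \<Rightarrow> bool" where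
  "pa_protocol P f V K \<epsilon> \<longleftrightarrow>
     finite V \<and> range f \<subseteq> V \<and> card V = K \<and>
     var_dist (map_pmf (\<lambda>(y, z). (f y, z)) P) (pair_pmf (pmf_of_set V) (map_pmf snd P)) \<le> \<epsilon>"

text \<open>Every finite output alphabet can be relabelled by natural numbers. For \<open>0 \<le> \<epsilon> < 1\<close>
  the largest \<open>K\<close> exists (lemma \<open>K_eps_protocol\<close> below). For \<open>\<epsilon> \<ge> 1\<close> every \<open>K \<ge> 1\<close> is
  achievable and the value is unspecified.\<close>

definition K_eps :: "real \<Rightarrow> ('y::finite \<times> 'z::finite) pmf \<Rightarrow> nat" where
  "K_eps \<epsilon> P = (GREATEST K. \<exists>(f :: 'y \<Rightarrow> nat) V. pa_protocol P f V K \<epsilon>)"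

definition lambda_feasible :: "real \<Rightarrow> ('y::finite \<times> 'z::finite) pmf \<Rightarrow> real \<Rightarrow> bool" where
  "lambda_feasible \<epsilon> P l \<longleftrightarrow>
     (\<exists>T :: 'y \<times> 'z \<Rightarrow> real.
        (\<forall>y z. l * pmf (map_pmf snd P) z \<ge> pmf P (y, z) - T (y, z)) \<and>
        (\<Sum>x\<in>UNIV. T x) \<le> \<epsilon> \<and> l \<ge> 0 \<and> (\<forall>x. T x \<ge> 0))"

text \<open>The minimum is attained for \<open>\<epsilon> \<ge> 0\<close> (lemma \<open>lambda_min_feasible\<close> below).\<close>

definition lambda_min :: "real \<Rightarrow> ('y::finite \<times> 'z::finite) pmf \<Rightarrow> real" where
  "lambda_min \<epsilon> P = (LEAST l. lambda_feasible \<epsilon> P l)"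

lemma lambda_feasible_iff:
  fixes P :: "('y::finite \<times> 'z::finite) pmf"
  shows "lambda_feasible \<epsilon> P l \<longleftrightarrow>
    l \<ge> 0 \<and> (\<Sum>x\<in>UNIV. max 0 (pmf P x - l * pmf (map_pmf snd P) (snd x))) \<le> \<epsilon>"
proof
  assume "lambda_feasible \<epsilon> P l"
  then obtain T :: "'y \<times> 'z \<Rightarrow> real" where
    T: "\<forall>y z. l * pmf (map_pmf snd P) z \<ge> pmf P (y, z) - T (y, z)"
       "(\<Sum>x\<in>UNIV. T x) \<le> \<epsilon>" "l \<ge> 0" "\<forall>x. T x \<ge> 0"
    unfolding lambda_feasible_def by blast
  have "max 0 (pmf P x - l * pmf (map_pmf snd P) (snd x)) \<le> T x" for x
  proof (cases x)
    case (Pair y z)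
    have "pmf P (y, z) - T (y, z) \<le> l * pmf (map_pmf snd P) z" "0 \<le> T (y, z)"
      using T(1,4) by blast+
    then show ?thesis unfolding Pair snd_conv by linarith
  qed
  then have "(\<Sum>x\<in>UNIV. max 0 (pmf P x - l * pmf (map_pmf snd P) (snd x))) \<le> (\<Sum>x\<in>UNIV. T x)"
    by (rule sum_mono)
  with T show "l \<ge> 0 \<and> (\<Sum>x\<in>UNIV. max 0 (pmf P x - l * pmf (map_pmf snd P) (snd x))) \<le> \<epsilon>"
    by linarith
next
  assume "l \<ge> 0 \<and> (\<Sum>x\<in>UNIV. max 0 (pmf P x - l * pmf (map_pmf snd P) (snd x))) \<le> \<epsilon>"
  then show "lambda_feasible \<epsilon> P l"
    unfolding lambda_feasible_def
    by (intro exI[of _ "\<lambda>x. max 0 (pmf P x - l * pmf (map_pmf snd P) (snd x))"]) auto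
qed

lemma pmf_le_pmf_snd:
  fixes P :: "('y::finite \<times> 'z::finite) pmf"
  shows "pmf P x \<le> pmf (map_pmf snd P) (snd x)"
proof -
  have "pmf P x = measure_pmf.prob P {x}" by (simp add: pmf.rep_eq)
  also have "\<dots> \<le> measure_pmf.prob P (snd -` {snd x})"
    by (rule measure_pmf.finite_measure_mono) auto
  finally show ?thesis by (simp add: pmf_map)
qed

lemma
  fixes P :: "('y::finite \<times> 'z::finite) pmf"
  assumes "\<epsilon> \<ge> 0"
  shows lambda_min_feasible: "lambda_feasible \<epsilon> P (lambda_min \<epsilon> P)"
    and lambda_min_le: "lambda_feasible \<epsilon> P l \<Longrightarrow> lambda_min \<epsilon> P \<le> l"
proof -
  define g where "g l = (\<Sum>x\<in>UNIV. max 0 (pmf P x - l * pmf (map_pmf snd P) (snd x)))" for l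
  define S where "S = {0..} \<inter> {l. g l \<le> \<epsilon>}"
  have S: "lambda_feasible \<epsilon> P l \<longleftrightarrow> l \<in> S" for l
    by (auto simp: lambda_feasible_iff S_def g_def)
  have "closed {l. g l \<le> \<epsilon>}"
    unfolding g_def by (intro closed_Collect_le continuous_intros)
  then have cl: "closed S" unfolding S_def by (intro closed_Int) auto
  have "g 1 = 0" unfolding g_def by (intro sum.neutral ballI) (simp add: pmf_le_pmf_snd)
  then have "1 \<in> S" using assms by (auto simp: S_def)
  moreover have bdd: "bdd_below S" by (auto simp: S_def)
  ultimately have Inf: "Inf S \<in> S" using closed_contains_Inf[OF _ bdd cl] by blast
  have "lambda_min \<epsilon> P = Inf S"
    unfolding lambda_min_def S
    by (rule Least_equality) (use Inf cInf_lower[OF _ bdd] in auto)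
  then show "lambda_feasible \<epsilon> P (lambda_min \<epsilon> P)"
    "lambda_feasible \<epsilon> P l \<Longrightarrow> lambda_min \<epsilon> P \<le> l"
    using Inf cInf_lower[OF _ bdd] by (auto simp: S)
qed

lemma pa_protocol_bound:
  fixes P :: "('y::finite \<times> 'z::finite) pmf"
  assumes "pa_protocol P f V K \<epsilon>"
  shows "real K * (1 - \<epsilon>) \<le> real CARD('y)"
proof -
  define U where "U = map_pmf (\<lambda>(y, z). (f y, z)) P"
  define W where "W = pair_pmf (pmf_of_set V) (map_pmf snd P)"
  have V: "finite V" "range f \<subseteq> V" "card V = K" "var_dist U W \<le> \<epsilon>"
    using assms by (auto simp: pa_protocol_def U_def W_def)
  then have ne: "V \<noteq> {}" by auto
  define A where "A = range f \<times> (UNIV :: 'z set)"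
  define S where "S = set_pmf U \<union> set_pmf W"
  have UA: "set_pmf U \<subseteq> A" by (auto simp: U_def A_def)
  have fin: "finite S" using V(1) ne by (auto simp: S_def U_def W_def)
  have sums: "(\<Sum>x\<in>S. pmf U x) = 1" "(\<Sum>x\<in>S. pmf W x) = 1"
    using fin by (auto intro!: sum_pmf_eq_1 simp: S_def)
  have sU: "(\<Sum>x\<in>S \<inter> A. pmf U x) = 1"
    using fin UA by (intro sum_pmf_eq_1) (auto simp: S_def)
  have sW: "(\<Sum>x\<in>S \<inter> A. pmf W x) \<le> measure_pmf.prob W A"
    using fin by (subst measure_measure_pmf_finite[symmetric])
      (auto intro: measure_pmf.finite_measure_mono)
  have "measure_pmf.prob W A = measure_pmf.prob (pmf_of_set V) (range f)"
  proof -
    have "measure_pmf.prob W A = measure_pmf.prob (map_pmf fst W) (range f)"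
      by (auto simp: A_def intro!: arg_cong[where f = "measure_pmf.prob W"])
    then show ?thesis by (simp add: W_def map_fst_pair_pmf)
  qed
  also have "\<dots> = real (card (range f)) / real K"
    using V ne by (simp add: measure_pmf_of_set Int_absorb1)
  also have "\<dots> \<le> real CARD('y) / real K"
    by (intro divide_right_mono) (auto intro: card_image_le)
  finally have pW: "measure_pmf.prob W A \<le> real CARD('y) / real K" .
  have "2 * (\<Sum>x\<in>S \<inter> A. pmf U x - pmf W x) - (\<Sum>x\<in>S. pmf U x - pmf W x)
        = (\<Sum>x\<in>S. (if x \<in> A then 1 else - 1) * (pmf U x - pmf W x))"
    using fin by (simp add: sum.inter_restrict sum_distrib_left flip: sum_subtractf)
      (intro sum.cong, auto)
  also have "\<dots> \<le> (\<Sum>x\<in>S. \<bar>pmf U x - pmf W x\<bar>)"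
    by (intro sum_mono) auto
  also have "\<dots> = 2 * var_dist U W" by (simp add: var_dist_def S_def)
  finally have "1 - real CARD('y) / real K \<le> \<epsilon>"
    using sums sU sW pW V(4) by (simp add: sum_subtractf)
  moreover have "K > 0" using V ne by (auto simp: card_gt_0_iff)
  ultimately show ?thesis by (simp add: field_simps)
qed

lemma pa_protocol_1:
  fixes P :: "('y::finite \<times> 'z::finite) pmf"
  assumes "\<epsilon> \<ge> 0"
  shows "pa_protocol P (\<lambda>_. 0 :: nat) {0} 1 \<epsilon>"
proof -
  have "map_pmf (\<lambda>(y, z). (0 :: nat, z)) P = map_pmf (Pair 0) (map_pmf snd P)"
    by (simp add: pmf.map_comp o_def case_prod_unfold)
  also have "\<dots> = pair_pmf (pmf_of_set {0}) (map_pmf snd P)"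
    by (simp add: pmf_of_set_singleton pair_return_pmf1)
  finally show ?thesis using assms
    by (simp add: pa_protocol_def var_dist_def)
qed

lemma
  fixes P :: "('y::finite \<times> 'z::finite) pmf"
  assumes "0 \<le> \<epsilon>" "\<epsilon> < 1"
  shows K_eps_protocol: "\<exists>(f :: 'y \<Rightarrow> nat) V. pa_protocol P f V (K_eps \<epsilon> P) \<epsilon>"
    and K_eps_ge: "pa_protocol P (f :: 'y \<Rightarrow> nat) V K \<epsilon> \<Longrightarrow> K \<le> K_eps \<epsilon> P"
proof -
  define Q where "Q K \<longleftrightarrow> (\<exists>(f :: 'y \<Rightarrow> nat) V. pa_protocol P f V K \<epsilon>)" for K
  have bound: "K \<le> nat \<lceil>real CARD('y) / (1 - \<epsilon>)\<rceil>" if "Q K" for K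
  proof -
    have "real K * (1 - \<epsilon>) \<le> real CARD('y)"
      using that pa_protocol_bound by (auto simp: Q_def)
    then have "real K \<le> real CARD('y) / (1 - \<epsilon>)" using assms by (simp add: field_simps)
    then show ?thesis by linarith
  qed
  have "Q 1" using pa_protocol_1[OF assms(1)] by (auto simp: Q_def)
  then have "Q (K_eps \<epsilon> P)"
    unfolding K_eps_def Q_def[symmetric] by (rule GreatestI_nat) (use bound in auto)
  then show "\<exists>(f :: 'y \<Rightarrow> nat) V. pa_protocol P f V (K_eps \<epsilon> P) \<epsilon>" by (simp add: Q_def)
  show "K \<le> K_eps \<epsilon> P" if "pa_protocol P (f :: 'y \<Rightarrow> nat) V K \<epsilon>"
    unfolding K_eps_def Q_def[symmetric]
    by (rule Greatest_le_nat) (use that bound in \<open>auto simp: Q_def\<close>)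
qed

end

theory Submission
  imports Defs
begin

text \<open>With \<open>\<gamma> = |Y| / K\<close> the vector \<open>\<gamma> (R\<^sub>Y \<times> P\<^sub>Z)\<close> is \<open>P\<^sub>Z / K\<close>, so \<open>E\<^sub>\<gamma>\<close> is the total
  positive part of \<open>P\<^sub>Y\<^sub>Z - P\<^sub>Z / K\<close>, which is the least mass of a slack vector \<open>T\<close> making
  \<open>\<lambda> = 1 / K\<close> feasible. Hence the bound on \<open>\<epsilon>\<close> for output size \<open>K\<close> says
  \<open>1 / K \<ge> \<lambda>\<^sub>m\<^sub>i\<^sub>n\<close>, which is strongest for the largest achievable \<open>K\<close>. For \<open>\<epsilon> \<ge> 1\<close>, where no
  largest \<open>K\<close> exists, both bounds hold because \<open>\<lambda>\<^sub>m\<^sub>i\<^sub>n = 0\<close>.\<close>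

lemma E_gamma_eq_sum:
  fixes P Q :: "'a::finite pmf"
  shows "E_gamma \<gamma> P Q = (\<Sum>x\<in>UNIV. max 0 (pmf P x - \<gamma> * pmf Q x))"
proof -
  define A where "A = {x. pmf P x \<ge> \<gamma> * pmf Q x}"
  have "E_gamma \<gamma> P Q = (\<Sum>x\<in>A. pmf P x - \<gamma> * pmf Q x)"
    by (simp add: E_gamma_def A_def Let_def measure_measure_pmf_finite sum_subtractf sum_distrib_left)
  also have "\<dots> = (\<Sum>x\<in>UNIV. if x \<in> A then pmf P x - \<gamma> * pmf Q x else 0)"
    using sum.inter_restrict[of UNIV _ A] by simp
  also have "\<dots> = (\<Sum>x\<in>UNIV. max 0 (pmf P x - \<gamma> * pmf Q x))"
    by (intro sum.cong) (auto simp: A_def)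
  finally show ?thesis .
qed

lemma E_gamma_uniform_eq_sum:
  fixes P :: "('y::finite \<times> 'z::finite) pmf"
  shows "E_gamma (CARD('y) / K) P (pair_pmf (pmf_of_set UNIV) (map_pmf snd P))
    = (\<Sum>x\<in>UNIV. max 0 (pmf P x - 1 / K * pmf (map_pmf snd P) (snd x)))"
  unfolding E_gamma_eq_sum
  by (intro sum.cong) (auto simp: pmf_pair split: prod.split)

text \<open>Feasibility is upward closed: the positive parts shrink as \<open>l\<close> grows, since
  the marginal of \<open>Z\<close> is nonnegative. The minimum itself is feasible.\<close>

lemma lambda_feasible_iff_lambda_min_le:
  assumes "\<epsilon> \<ge> 0"
  shows "lambda_feasible \<epsilon> P l \<longleftrightarrow> lambda_min \<epsilon> P \<le> l"
proof
  assume le: "lambda_min \<epsilon> P \<le> l"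
  let ?g = "\<lambda>l. \<Sum>x\<in>UNIV. max 0 (pmf P x - l * pmf (map_pmf snd P) (snd x))"
  have "?g l \<le> ?g (lambda_min \<epsilon> P)"
    using le by (intro sum_mono max.mono diff_mono mult_right_mono) auto
  then show "lambda_feasible \<epsilon> P l"
    using lambda_min_feasible[OF assms, of P] le unfolding lambda_feasible_iff by linarith
qed (rule lambda_min_le[OF assms])

lemma E_gamma_le_iff_lambda_min_le:
  fixes P :: "('y::finite \<times> 'z::finite) pmf"
  assumes "\<epsilon> \<ge> 0"
  shows "E_gamma (CARD('y) / real K) P (pair_pmf (pmf_of_set UNIV) (map_pmf snd P)) \<le> \<epsilon>
    \<longleftrightarrow> lambda_min \<epsilon> P \<le> 1 / real K"
  by (simp add: E_gamma_uniform_eq_sum lambda_feasible_iff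
      flip: lambda_feasible_iff_lambda_min_le[OF assms])

lemma pa_protocol_pos:
  assumes "pa_protocol P f V K \<epsilon>"
  shows "K > 0"
  using assms by (auto simp: pa_protocol_def card_gt_0_iff)

text \<open>The slack vector \<open>T = P\<close> has mass 1, so it makes 0 feasible.\<close>

lemma lambda_min_nonpos:
  assumes "\<epsilon> \<ge> 1"
  shows "lambda_min \<epsilon> P \<le> 0"
proof -
  have "(\<Sum>x\<in>UNIV. pmf P x) = 1" by (rule sum_pmf_eq_1) auto
  then have "lambda_feasible \<epsilon> P 0" using assms by (simp add: lambda_feasible_iff)
  then show ?thesis using assms by (intro lambda_min_le) auto
qed

theorem proposition2:
  fixes P :: "('y::finite \<times> 'z::finite) pmf"
  assumes "\<epsilon> \<ge> 0"
  shows "((\<forall>K V (f :: 'y \<Rightarrow> nat). pa_protocol P f V K \<epsilon> \<longrightarrow>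
             \<epsilon> \<ge> E_gamma (CARD('y) / K) P (pair_pmf (pmf_of_set UNIV) (map_pmf snd P)))
          \<longleftrightarrow> 1 / real (K_eps \<epsilon> P) \<ge> lambda_min \<epsilon> P)
       \<and> (\<forall>K::nat. K > 0 \<longrightarrow>
            (\<epsilon> \<ge> E_gamma (CARD('y) / K) P (pair_pmf (pmf_of_set UNIV) (map_pmf snd P))
             \<longleftrightarrow> 1 / real K \<ge> lambda_min \<epsilon> P))"
proof -
  have "(\<forall>K V (f :: 'y \<Rightarrow> nat). pa_protocol P f V K \<epsilon> \<longrightarrow> lambda_min \<epsilon> P \<le> 1 / real K)
    \<longleftrightarrow> lambda_min \<epsilon> P \<le> 1 / real (K_eps \<epsilon> P)"
  proof (cases "\<epsilon> < 1")
    case True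
    show ?thesis
    proof (intro iffI allI impI)
      assume all: "\<forall>K V (f :: 'y \<Rightarrow> nat). pa_protocol P f V K \<epsilon> \<longrightarrow> lambda_min \<epsilon> P \<le> 1 / real K"
      obtain f :: "'y \<Rightarrow> nat" and V where "pa_protocol P f V (K_eps \<epsilon> P) \<epsilon>"
        using K_eps_protocol[OF assms True, of P] by blast
      then show "lambda_min \<epsilon> P \<le> 1 / real (K_eps \<epsilon> P)" by (rule all[rule_format])
    next
      fix K V and f :: "'y \<Rightarrow> nat"
      assume le: "lambda_min \<epsilon> P \<le> 1 / real (K_eps \<epsilon> P)" and prot: "pa_protocol P f V K \<epsilon>"
      \<comment> \<open>\<open>K > 0\<close> matters here: \<open>1 / K\<close> is not antitone at
        0, where \<open>1 / 0 = 0\<close>.\<close>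
      have "1 / real (K_eps \<epsilon> P) \<le> 1 / real K"
        using K_eps_ge[OF assms True prot] pa_protocol_pos[OF prot] by (intro divide_left_mono) auto
      with le show "lambda_min \<epsilon> P \<le> 1 / real K" by linarith
    qed
  next
    case False
    \<comment> \<open>\<open>K_eps\<close> may be any natural number here, so the bound is shown for
      all of them, including 0 with \<open>1 / 0 = 0\<close>.\<close>
    then have "lambda_min \<epsilon> P \<le> 1 / real K" for K :: nat
      using order.trans[OF lambda_min_nonpos[of \<epsilon> P], of "1 / real K"] by simp
    then show ?thesis by blast
  qed
  then show ?thesis
    by (simp add: E_gamma_le_iff_lambda_min_le[OF assms])
qed

end
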